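(* Let $\overline{\eta} = \frac{135}{98}+\frac{19}{98}\sqrt{57}$ be the positive root of $49\eta^2-135\eta-12$. Consider the system of polynomial equations in the unknowns $X,Y,\rho$ with parameters $\lambda,\eta$: $$ \begin{aligned} 3(X-Y+\lambda)^2+4\eta X-12\lambda X &= 0,\\ 3Y^2-4\rho(3Y-\eta) &= 0,\\ 4\rho\big(4Y\lambda-(X-Y-\lambda)^2-\eta X\big)-X(4\lambda Y-\eta X) &= 0. \end{aligned} $$ The solutions to this system correspond to one of the following cases (unless otherwise stated, $\lambda=1$ and $\eta$ is free): 1. $(X,Y,\rho) = \left(0,1,\frac{3}{12-4\eta}\right)$; 2. $(X,Y,\rho) = \left(\frac{12}{12-4\eta},\frac{4\eta}{12-4\eta},\frac{3}{12-4\eta}\right)$; 3. for $\eta \in (0,\overline{\eta})$, except the solutions of items 1 and 2, there is a unique real and positive solution $\rho = \rho(\eta)$ and one corresponding point $O^*$; 4. for $\eta \in (\overline{\eta},3)$, except the solutions of items 1 and 2, there are three real and positive solutions $\rho = \rho_1(\eta), \rho_2(\eta), \rho_3(\eta)$ and three corresponding points $O^*_1,O^*_2,O^*_3$; 5. $\lambda=0$ or $\eta \leq 0$ or $\eta \geq 3$; 6. complex (non-real) solutions.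
   Context: Geometric setting: $T=\mathrm{co}(V)$, $V=\{v_0,v_1,v_2,v_3\}\subset\mathbb{R}^3$, is a triangular pyramid: the face with vertices $v_1,v_2,v_3$ is equilateral with squared edge length $\eta$, and $v_0$ is at squared distance $\lambda$ from each of $v_1,v_2,v_3$ (a solid pyramid exists iff $0<\eta<3\lambda$). For $\lambda=1$ and $0<\eta<3$ one fixes the coordinates $v_0=(0,0,\sqrt{(3-\eta)/3})$, $v_1=(0,\sqrt{\eta/3},0)$, $v_2=(-\sqrt{\eta}/2,-\tfrac12\sqrt{\eta/3},0)$, $v_3=(\sqrt{\eta}/2,-\tfrac12\sqrt{\eta/3},0)$. The unknown $X$ is the squared distance of a point $O^*$ to $v_0$, $Y$ is its common squared distance to $v_1,v_2,v_3$, and $\rho$ is the squared common radius of four spheres $S_0,\dots,S_3$ such that $S_j$ contains $O^*$ and all $v_i$ with $i\ne j$. The point $O^*$ corresponding to a real solution is the point of $\mathbb{R}^3$ whose squared distances to $v_0,v_1,v_2,v_3$ are $X,Y,Y,Y$ respectively; it has the form $O^*=(0,0,z)$ with $X=(z-\sqrt{(3-\eta)/3})^2$ and $Y=z^2+\eta/3$.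
   Formalization: At η=12/5 item 3's solution coincides with item 1, so it is not claimed to differ (ρ(η) is a continuous branch); at η=20/7 two of item 4's ρ values coincide, so distinct ρ is not claimed; η/λ=η̄, where unlisted real solutions exist, is excluded from exhaustiveness. *)

theory Defs
  imports "HOL-Analysis.Analysis"
begin

text \<open>
  The base face of the pyramid has squared edge length \<open>\<eta>\<close>; the apex has squared distance \<open>l\<close>
  from each base vertex. A triple \<open>(X, Y, \<rho>)\<close> of unknowns may be real or complex, while the
  parameters \<open>l\<close> and \<open>\<eta>\<close> are always real.
\<close>

fun is_solution :: "real \<Rightarrow> real \<Rightarrow> 'a::real_field \<times> 'a \<times> 'a \<Rightarrow> bool" where
  "is_solution l \<eta> (X, Y, \<rho>) \<longleftrightarrow>
     3 * (X - Y + of_real l)\<^sup>2 + 4 * of_real \<eta> * X - 12 * of_real l * X = 0 \<and>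
     3 * Y\<^sup>2 - 4 * \<rho> * (3 * Y - of_real \<eta>) = 0 \<and>
     4 * \<rho> * (4 * Y * of_real l - (X - Y - of_real l)\<^sup>2 - of_real \<eta> * X)
       - X * (4 * of_real l * Y - of_real \<eta> * X) = 0"

fun cplx_triple :: "real \<times> real \<times> real \<Rightarrow> complex \<times> complex \<times> complex" where
  "cplx_triple (X, Y, \<rho>) = (of_real X, of_real Y, of_real \<rho>)"

fun rho :: "real \<times> real \<times> real \<Rightarrow> real" where
  "rho (X, Y, \<rho>) = \<rho>"

definition eta_bar :: real where
  "eta_bar = 135 / 98 + 19 / 98 * sqrt 57"

definition sol1 :: "real \<Rightarrow> real \<times> real \<times> real" where
  "sol1 \<eta> = (0, 1, 3 / (12 - 4 * \<eta>))"

definition sol2 :: "real \<Rightarrow> real \<times> real \<times> real" where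
  "sol2 \<eta> = (12 / (12 - 4 * \<eta>), 4 * \<eta> / (12 - 4 * \<eta>), 3 / (12 - 4 * \<eta>))"

text \<open>
  Two parameter values are special. For \<open>l = 1\<close> and \<open>0 < \<eta> < 3\<close> put \<open>t = (3 - \<eta>) / \<eta>\<close>. The solutions
  other than \<open>sol1\<close> and \<open>sol2\<close> come from the roots \<open>u\<close> of \<open>4 * u^3 + 2 * u^2 + t * u - t\<close>, with
  \<open>O = (0, 0, z)\<close>, \<open>z = (\<eta> / 3) * u / sqrt ((3 - \<eta>) / 3)\<close>, and conversely every root gives a solution.
  At \<open>\<eta> = 12 / 5\<close> the only real root is \<open>u = t = 1 / 4\<close>; then \<open>O\<close> is the apex and the solution
  is \<open>sol1\<close> itself. At \<open>\<eta> = 20 / 7\<close>, which lies in \<open>(eta_bar, 3)\<close>, two of the three real roots give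
  distinct points but the same value of \<open>\<rho>\<close>.
\<close>

text \<open>Vertices of the pyramid for \<open>l = 1\<close> and \<open>0 < \<eta> < 3\<close>.\<close>

definition v0 :: "real \<Rightarrow> real ^ 3" where
  "v0 \<eta> = vector [0, 0, sqrt ((3 - \<eta>) / 3)]"

definition v1 :: "real \<Rightarrow> real ^ 3" where
  "v1 \<eta> = vector [0, sqrt (\<eta> / 3), 0]"

definition v2 :: "real \<Rightarrow> real ^ 3" where
  "v2 \<eta> = vector [- sqrt \<eta> / 2, - (1 / 2) * sqrt (\<eta> / 3), 0]"

definition v3 :: "real \<Rightarrow> real ^ 3" where
  "v3 \<eta> = vector [sqrt \<eta> / 2, - (1 / 2) * sqrt (\<eta> / 3), 0]"

fun corresponds :: "real \<Rightarrow> real \<times> real \<times> real \<Rightarrow> real ^ 3 \<Rightarrow> bool" where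
  "corresponds \<eta> (X, Y, \<rho>) P \<longleftrightarrow>
     (dist P (v0 \<eta>))\<^sup>2 = X \<and> (dist P (v1 \<eta>))\<^sup>2 = Y \<and>
     (dist P (v2 \<eta>))\<^sup>2 = Y \<and> (dist P (v3 \<eta>))\<^sup>2 = Y"

end

theory Submission
  imports Defs
begin

text \<open>
  For \<open>l = 1\<close> and \<open>0 < \<eta> < 3\<close> the first equation says that \<open>X\<close> and \<open>Y\<close> are the squared distances
  from a point \<open>(0, 0, z)\<close> on the axis of the pyramid to the apex and to the base vertices. It is
  therefore solved by one real parameter. A convenient one is \<open>u = 3 * h * z / \<eta>\<close>, where
  \<open>h = sqrt ((3 - \<eta>) / 3)\<close> is the height of the pyramid, and the shape is best measured by
  \<open>t = (3 - \<eta>) / \<eta>\<close>, so that \<open>\<eta> = 3 / (1 + t)\<close>: with these, \<open>X\<close> and \<open>Y\<close> are rational in \<open>t\<close> and \<open>u\<close>.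
  The second equation forces \<open>u \<noteq> 0\<close> and expresses \<open>\<rho>\<close> by \<open>u\<close> (\<open>branch\<close>). The third one becomes
  \<open>(u - t) * (u + 1) * cubic t u = 0\<close> up to multiplicity and nonzero factors
  (\<open>is_solution_branch_iff\<close>). The root \<open>u = t\<close> is the apex and gives \<open>sol1\<close>; the root \<open>u = - 1\<close> is the
  antipode of the apex on the circumscribed sphere of the pyramid and gives \<open>sol2\<close>; everything
  else comes from the cubic \<open>4 * u^3 + 2 * u^2 + t * u - t\<close>.

  So the theorem is a count of the real roots of this cubic. It has exactly one positive root for
  every \<open>t > 0\<close>, and as a function of \<open>t\<close> that root inverts a strictly increasing continuous function
  of \<open>u\<close>, hence is continuous (\<open>ex_continuous_positive_root\<close>). The discriminant is
  \<open>- 4 * t * (4 * t^2 + 143 * t - 8)\<close>, whose positive root \<open>t_crit\<close> corresponds to \<open>eta_bar\<close>. At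
  \<open>t_crit\<close> the cubic has a negative double root and an explicit factorization (\<open>cubic_t_crit\<close>). Since
  the cubic depends on \<open>t\<close> only through the summand \<open>t * (u - 1)\<close>, raising \<open>t\<close> pushes its graph down on
  \<open>u < 1\<close>: above \<open>t_crit\<close> there is no negative root, below \<open>t_crit\<close> the double root splits in two.

  The map from \<open>u\<close> to the triple is injective, so distinct roots give distinct solutions and distinct
  points. The values of \<open>\<rho>\<close> at two roots can agree only if the roots have product \<open>t\<close> or \<open>- t\<close>, or
  sum \<open>0\<close>. The relations between roots and coefficients then determine the third root and leave
  \<open>t = 1 / 4\<close>, which is above \<open>t_crit\<close>, and \<open>t = 1 / 20\<close>, which is \<open>\<eta> = 20 / 7\<close>
  (\<open>roots_equal_rho\<close>).

  The system is homogeneous in the unknowns and parameters together, which reduces every \<open>l \<noteq> 0\<close> to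
  \<open>l = 1\<close>. A complex solution is either non-real, which is a case of its own, or the image of a
  real one.
\<close>

section \<open>Parametrization of the solutions\<close>

definition cubic :: "real \<Rightarrow> real \<Rightarrow> real" where
  "cubic t u = 4 * u ^ 3 + 2 * u\<^sup>2 + t * u - t"

definition branch :: "real \<Rightarrow> real \<Rightarrow> real \<times> real \<times> real" where
  "branch t u = ((u - t)\<^sup>2 / (t * (1 + t)), (u\<^sup>2 + t) / (t * (1 + t)),
     (u\<^sup>2 + t)\<^sup>2 / (4 * t * (1 + t) * u\<^sup>2))"

lemma sol1_eq_branch:
  assumes "t > 0"
  shows "sol1 (3 / (1 + t)) = branch t t"
  using assms unfolding sol1_def branch_def
  by (simp add: divide_simps power2_eq_square) (simp add: algebra_simps)

lemma sol2_eq_branch: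
  assumes "t > 0"
  shows "sol2 (3 / (1 + t)) = branch t (- 1)"
  using assms unfolding sol2_def branch_def
  by (simp add: divide_simps power2_eq_square) (simp add: algebra_simps)

text \<open>
  A branch point satisfies the first two equations identically. In the third one, the bracket that
  multiplies \<open>4 * \<rho>\<close> collapses to \<open>X / (1 + t)\<close>, so \<open>X\<close> splits off; it accounts for the factor
  \<open>u - t\<close>. The remaining factor is a quartic in \<open>u\<close> that is divisible by \<open>u + 1\<close>.
\<close>

lemma is_solution_branch_iff:
  assumes t: "t > 0" and u: "u \<noteq> 0"
  shows "is_solution 1 (3 / (1 + t)) (branch t u) \<longleftrightarrow> (u - t) * ((u + 1) * cubic t u) = 0"
proof -
  define X Y r where "X = (u - t)\<^sup>2 / (t * (1 + t))" and "Y = (u\<^sup>2 + t) / (t * (1 + t))"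
    and "r = (u\<^sup>2 + t)\<^sup>2 / (4 * t * (1 + t) * u\<^sup>2)"
  have t1: "1 + t \<noteq> 0" "t \<noteq> 0" using t by auto
  have 1: "3 * (X - Y + 1)\<^sup>2 + 4 * (3 / (1 + t)) * X - 12 * X = 0"
    using t1 unfolding X_def Y_def
    by (simp add: divide_simps power2_eq_square) (simp add: algebra_simps)
  have 2: "3 * Y\<^sup>2 - 4 * r * (3 * Y - 3 / (1 + t)) = 0"
    using t1 u unfolding r_def Y_def by (simp add: divide_simps power2_eq_square)
  have a: "4 * Y - (X - Y - 1)\<^sup>2 - 3 / (1 + t) * X = X / (1 + t)"
    using t1 u unfolding X_def Y_def
    by (simp add: divide_simps power2_eq_square) (simp add: algebra_simps)
  have b: "4 * r / (1 + t) - (4 * Y - 3 / (1 + t) * X) = - ((u + 1) * cubic t u) / ((1 + t) * u)\<^sup>2"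
    using t1 u unfolding X_def Y_def r_def cubic_def
    by (simp add: divide_simps power2_eq_square power3_eq_cube) (simp add: algebra_simps)
  have "4 * r * (4 * Y - (X - Y - 1)\<^sup>2 - 3 / (1 + t) * X) - X * (4 * Y - 3 / (1 + t) * X)
      = X * (4 * r / (1 + t) - (4 * Y - 3 / (1 + t) * X))"
    unfolding a by (simp add: algebra_simps)
  also have "\<dots> = X * (- ((u + 1) * cubic t u) / ((1 + t) * u)\<^sup>2)"
    unfolding b ..
  also have "\<dots> = 0 \<longleftrightarrow> (u - t) * ((u + 1) * cubic t u) = 0"
    using t1 u by (auto simp: X_def)
  finally show ?thesis
    using 1 2 by (simp add: branch_def X_def [symmetric] Y_def [symmetric] r_def [symmetric])
qed

text \<open>
  On a branch \<open>X - Y\<close> is affine in \<open>u\<close>, which dictates how to recover \<open>u\<close> from a solution. The first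
  equation then gives \<open>X\<close>, and the second one excludes \<open>u = 0\<close>, where it would read \<open>3 * Y\<^sup>2 = 0\<close>
  although \<open>Y > 0\<close>.
\<close>

lemma is_solution_imp_branch:
  assumes t: "t > 0" and s: "is_solution 1 (3 / (1 + t)) s"
  obtains u where "u \<noteq> 0" "s = branch t u"
proof -
  obtain X Y r where sXY: "s = (X, Y, r)" by (cases s)
  define u where "u = (t - 1 - (1 + t) * (X - Y)) / 2"
  have t1: "1 + t \<noteq> 0" "t \<noteq> 0" using t by auto
  have XY: "X - Y = (t - 1 - 2 * u) / (1 + t)"
    using t1 by (simp add: u_def field_simps)
  have e1: "3 * (X - Y + 1)\<^sup>2 + 4 * (3 / (1 + t)) * X - 12 * X = 0"
    and e2: "3 * Y\<^sup>2 - 4 * r * (3 * Y - 3 / (1 + t)) = 0"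
    using s by (auto simp: sXY)
  have XY1: "X - Y + 1 = 2 * (t - u) / (1 + t)"
    using t1 by (simp add: XY field_simps)
  have "12 - 12 / (1 + t) = 12 * t / (1 + t)"
    using t1 by (simp add: field_simps)
  moreover have "3 * (X - Y + 1)\<^sup>2 = (12 - 12 / (1 + t)) * X"
    using e1 by (simp add: left_diff_distrib)
  ultimately have "3 * (2 * (t - u) / (1 + t))\<^sup>2 = 12 * t / (1 + t) * X"
    by (simp add: XY1)
  then have "(t - u)\<^sup>2 = t * (1 + t) * X"
    using t1 by (simp add: divide_simps power2_eq_square) (simp add: algebra_simps)
  then have X: "X = (u - t)\<^sup>2 / (t * (1 + t))"
    using t1 by (simp add: power2_commute)
  have "Y = X - (t - 1 - 2 * u) / (1 + t)" using XY by simp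
  then have Y: "Y = (u\<^sup>2 + t) / (t * (1 + t))"
    unfolding X using t1 by (simp add: divide_simps power2_eq_square) (simp add: algebra_simps)
  have e2': "(u\<^sup>2 + t)\<^sup>2 = 4 * t * (1 + t) * u\<^sup>2 * r"
    using e2 t1 unfolding Y by (simp add: divide_simps power2_eq_square)
  have u: "u \<noteq> 0" using e2' t by auto
  then have "s = branch t u"
    using e2' t1 by (simp add: sXY X Y branch_def)
  with u show thesis by (rule that)
qed

lemma branch_inj:
  assumes "t > 0" "branch t u = branch t v"
  shows "u = v"
proof -
  have *: "fst (branch t w) - fst (snd (branch t w)) = (t - 1 - 2 * w) / (1 + t)" for w
    using assms(1) unfolding branch_def
    by (simp add: divide_simps power2_eq_square) (simp add: algebra_simps)
  show ?thesis using *[of u] *[of v] assms by (simp add: field_simps)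
qed

lemma rho_branch_pos: "t > 0 \<Longrightarrow> u \<noteq> 0 \<Longrightarrow> rho (branch t u) > 0"
  using add_nonneg_pos [of "u\<^sup>2" t] by (simp add: branch_def)

section \<open>The corresponding points\<close>

lemma dist_vector_3_power2:
  "(dist P (vector [a, b, c] :: real ^ 3))\<^sup>2 = (P $ 1 - a)\<^sup>2 + (P $ 2 - b)\<^sup>2 + (P $ 3 - c)\<^sup>2"
  by (simp add: dist_norm norm_vec_def L2_set_def sum_3)

definition axis_point :: "real \<Rightarrow> real \<Rightarrow> real ^ 3" where
  "axis_point t u = vector [0, 0, u / sqrt (t * (1 + t))]"

lemma axis_point_inj: "t > 0 \<Longrightarrow> axis_point t u = axis_point t v \<Longrightarrow> u = v"
  by (auto simp: axis_point_def vec_eq_iff forall_3)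

text \<open>
  Equal distances to the three base vertices force the point onto the axis. There the difference of the
  squared distances to the apex and to the base is affine in the height, so the point is unique.
\<close>

lemma corresponds_branch_iff:
  assumes t: "t > 0"
  shows "corresponds (3 / (1 + t)) (branch t u) P \<longleftrightarrow> P = axis_point t u"
proof -
  define x y z where "x = P $ 1" and "y = P $ 2" and "z = P $ 3"
  define e k where "e = 3 / (1 + t)" and "k = u / sqrt (t * (1 + t))"
  define h b c where "h = sqrt ((3 - e) / 3)" and "b = sqrt (e / 3)" and "c = sqrt e"
  have e: "e > 0" "(3 - e) / 3 = t / (1 + t)" "e / 3 = 1 / (1 + t)" using t
    by (simp_all add: e_def field_simps)
  have h: "h > 0" "h\<^sup>2 = t / (1 + t)" unfolding h_def e(2) using t by simp_all
  have b: "b > 0" "b\<^sup>2 = 1 / (1 + t)" unfolding b_def e(3) using t by simp_all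
  have c: "c > 0" "c\<^sup>2 = 3 * b\<^sup>2" using t e by (simp_all add: c_def b e_def)
  have "sqrt (t * (1 + t)) = h * (1 + t)"
    using t h by (intro real_sqrt_unique)
      (simp_all add: power_mult_distrib power2_eq_square [of "1 + t"])
  then have hk: "h * k = u / (1 + t)"
    using h(1) by (simp add: k_def)
  have k2: "k\<^sup>2 = u\<^sup>2 / (t * (1 + t))" using t by (simp add: k_def power_divide)
  have "(k - h)\<^sup>2 = k\<^sup>2 - 2 * (h * k) + h\<^sup>2" by (simp add: power2_diff)
  also have "\<dots> = (u - t)\<^sup>2 / (t * (1 + t))"
    unfolding k2 h(2) hk using t
    by (simp add: divide_simps power2_eq_square) (simp add: algebra_simps)
  finally have X: "(k - h)\<^sup>2 = (u - t)\<^sup>2 / (t * (1 + t))" .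
  have Y: "k\<^sup>2 + b\<^sup>2 = (u\<^sup>2 + t) / (t * (1 + t))"
    unfolding k2 b(2) using t by (simp add: divide_simps)
  have "corresponds e (branch t u) P \<longleftrightarrow>
     x\<^sup>2 + y\<^sup>2 + (z - h)\<^sup>2 = (k - h)\<^sup>2 \<and> x\<^sup>2 + (y - b)\<^sup>2 + z\<^sup>2 = k\<^sup>2 + b\<^sup>2 \<and>
     (x + c / 2)\<^sup>2 + (y + b / 2)\<^sup>2 + z\<^sup>2 = k\<^sup>2 + b\<^sup>2 \<and>
     (x - c / 2)\<^sup>2 + (y + b / 2)\<^sup>2 + z\<^sup>2 = k\<^sup>2 + b\<^sup>2"
    unfolding branch_def corresponds.simps X [symmetric] Y [symmetric] v0_def v1_def v2_def v3_def
      dist_vector_3_power2 by (simp add: x_def y_def z_def h_def b_def c_def)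
  also have "\<dots> \<longleftrightarrow> x = 0 \<and> y = 0 \<and> z = k"
  proof safe
    assume 0: "x\<^sup>2 + y\<^sup>2 + (z - h)\<^sup>2 = (k - h)\<^sup>2" and 1: "x\<^sup>2 + (y - b)\<^sup>2 + z\<^sup>2 = k\<^sup>2 + b\<^sup>2"
      and 2: "(x + c / 2)\<^sup>2 + (y + b / 2)\<^sup>2 + z\<^sup>2 = k\<^sup>2 + b\<^sup>2"
      and 3: "(x - c / 2)\<^sup>2 + (y + b / 2)\<^sup>2 + z\<^sup>2 = k\<^sup>2 + b\<^sup>2"
    have "2 * (c * x) = (x + c / 2)\<^sup>2 - (x - c / 2)\<^sup>2"
      by (simp add: power2_eq_square algebra_simps)
    with 2 3 have "c * x = 0" by linarith
    then show x0: "x = 0" using c by simp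
    have "3 * (b * y) = (y + b / 2)\<^sup>2 - (y - b)\<^sup>2 + 3 / 4 * b\<^sup>2"
      by (simp add: power2_eq_square algebra_simps)
    moreover have "(x - c / 2)\<^sup>2 = 3 / 4 * b\<^sup>2" using x0 c(2) by (simp add: power_divide)
    moreover have "x\<^sup>2 = 0" using x0 by simp
    ultimately have "b * y = 0" using 1 3 by linarith
    then show y0: "y = 0" using b by simp
    have "2 * (h * (z - k)) = z\<^sup>2 - k\<^sup>2 - (z - h)\<^sup>2 + (k - h)\<^sup>2"
      by (simp add: power2_eq_square algebra_simps)
    with 0 1 x0 y0 have "h * (z - k) = 0" by simp
    then show "z = k" using h by simp
  qed (use c(2) in \<open>auto simp: power_divide\<close>)
  also have "\<dots> \<longleftrightarrow> P = axis_point t u"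
    by (simp add: axis_point_def vec_eq_iff forall_3 x_def y_def z_def k_def)
  finally show ?thesis by (simp add: e_def)
qed

section \<open>Scaling, real and complex solutions\<close>

text \<open>
  Under \<open>X, Y, \<rho>, l, \<eta> \<mapsto> c * X, c * Y, c * \<rho>, c * l, c * \<eta>\<close> the three equations scale by
  \<open>c^2\<close>, \<open>c^2\<close> and \<open>c^3\<close>.
\<close>

lemma is_solution_homogeneous:
  fixes s :: "complex \<times> complex \<times> complex"
  assumes "l \<noteq> 0"
  shows "is_solution l \<eta> s \<longleftrightarrow> is_solution 1 (\<eta> / l) (s /\<^sub>R l)"
proof -
  obtain X Y r where s: "s = (X, Y, r)" by (cases s)
  define L H where "L = complex_of_real l" and "H = complex_of_real \<eta>"
  have L: "L \<noteq> 0" using assms by (simp add: L_def)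
  have 1: "3 * (X / L - Y / L + 1)\<^sup>2 + 4 * (H / L) * (X / L) - 12 * (X / L)
     = (3 * (X - Y + L)\<^sup>2 + 4 * H * X - 12 * L * X) / L\<^sup>2"
    using L by (simp add: divide_simps power2_eq_square)
  have 2: "3 * (Y / L)\<^sup>2 - 4 * (r / L) * (3 * (Y / L) - H / L)
     = (3 * Y\<^sup>2 - 4 * r * (3 * Y - H)) / L\<^sup>2"
    using L by (simp add: divide_simps power2_eq_square)
  have 3: "4 * (r / L) * (4 * (Y / L) - (X / L - Y / L - 1)\<^sup>2 - H / L * (X / L))
       - (X / L) * (4 * (Y / L) - H / L * (X / L))
     = (4 * r * (4 * Y * L - (X - Y - L)\<^sup>2 - H * X) - X * (4 * L * Y - H * X)) / L ^ 3"
    using L by (simp add: divide_simps power2_eq_square power3_eq_cube) (simp add: algebra_simps)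
  have "s /\<^sub>R l = (X / L, Y / L, r / L)"
    using assms by (simp add: s L_def scaleR_conv_of_real field_simps)
  then have "is_solution 1 (\<eta> / l) (s /\<^sub>R l) \<longleftrightarrow>
     (3 * (X - Y + L)\<^sup>2 + 4 * H * X - 12 * L * X) / L\<^sup>2 = 0 \<and>
     (3 * Y\<^sup>2 - 4 * r * (3 * Y - H)) / L\<^sup>2 = 0 \<and>
     (4 * r * (4 * Y * L - (X - Y - L)\<^sup>2 - H * X) - X * (4 * L * Y - H * X)) / L ^ 3 = 0"
    unfolding 1 [symmetric] 2 [symmetric] 3 [symmetric] by (simp add: L_def H_def)
  then show ?thesis using L by (simp add: s L_def H_def)
qed

lemma is_solution_cplx_triple_iff:
  "is_solution l \<eta> (cplx_triple s) \<longleftrightarrow> is_solution l \<eta> s"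
proof -
  obtain X Y r where s: "s = (X, Y, r)" by (cases s)
  have c: "of_real z = (0::complex) \<longleftrightarrow> z = 0" for z by simp
  show ?thesis unfolding s cplx_triple.simps is_solution.simps
    unfolding c [symmetric] by (simp del: of_real_eq_0_iff)
qed

lemma is_solution_sol1: "\<eta> \<noteq> 3 \<Longrightarrow> is_solution 1 \<eta> (sol1 \<eta>)"
  by (simp add: sol1_def field_simps)

lemma is_solution_sol2: "\<eta> \<noteq> 3 \<Longrightarrow> is_solution 1 \<eta> (sol2 \<eta>)"
  unfolding sol2_def is_solution.simps
  by (simp add: divide_simps power2_eq_square) (simp add: algebra_simps)

section \<open>Solutions as roots of the cubic\<close>

lemma is_solution_iff_cubic_root:
  assumes t: "t > 0"
  shows "is_solution 1 (3 / (1 + t)) s \<longleftrightarrow>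
    s \<in> {sol1 (3 / (1 + t)), sol2 (3 / (1 + t))} \<or> (\<exists>u. cubic t u = 0 \<and> s = branch t u)"
proof -
  have nz: "u \<noteq> 0" if "cubic t u = 0" for u
    using that t by (auto simp: cubic_def)
  have "is_solution 1 (3 / (1 + t)) s \<longleftrightarrow>
      (\<exists>u. u \<noteq> 0 \<and> s = branch t u \<and> (u = t \<or> u = - 1 \<or> cubic t u = 0))"
    (is "_ \<longleftrightarrow> ?R")
  proof
    assume s: "is_solution 1 (3 / (1 + t)) s"
    obtain u where "u \<noteq> 0" "s = branch t u" by (rule is_solution_imp_branch [OF t s])
    with s show ?R by (auto simp: is_solution_branch_iff [OF t])
  qed (auto simp: is_solution_branch_iff [OF t])
  also have "\<dots> \<longleftrightarrow> s \<in> {branch t t, branch t (- 1)} \<or> (\<exists>u. cubic t u = 0 \<and> s = branch t u)"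
    using t nz by (auto intro: exI [of _ t] exI [of _ "- 1"])
  finally show ?thesis using t by (simp add: sol1_eq_branch sol2_eq_branch)
qed

lemma branch_root_eq_sol1_iff:
  assumes t: "t > 0" and u: "cubic t u = 0"
  shows "branch t u = sol1 (3 / (1 + t)) \<longleftrightarrow> u = t"
  using branch_inj [OF t, of u t] t by (auto simp: sol1_eq_branch)

text \<open>
  The value \<open>t = 1 / 4\<close>, that is \<open>\<eta> = 12 / 5\<close>, is the only one at which a root of the cubic leads back
  to \<open>sol1\<close>.
\<close>

lemma cubic_self_eq_0_iff: "t > 0 \<Longrightarrow> cubic t t = 0 \<longleftrightarrow> t = 1 / 4"
proof -
  assume "t > 0"
  have "cubic t t = t * ((4 * t - 1) * (t + 1))"
    by (simp add: cubic_def power2_eq_square power3_eq_cube algebra_simps)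
  with \<open>t > 0\<close> show ?thesis by auto
qed

lemma branch_root_noteq_sol2:
  assumes t: "t > 0" and u: "cubic t u = 0"
  shows "branch t u \<noteq> sol2 (3 / (1 + t))"
proof
  assume "branch t u = sol2 (3 / (1 + t))"
  then have "u = - 1" using branch_inj [OF t, of u "- 1"] t by (simp add: sol2_eq_branch)
  with u t show False by (simp add: cubic_def)
qed

lemma sol1_noteq_sol2: "t > 0 \<Longrightarrow> sol1 (3 / (1 + t)) \<noteq> sol2 (3 / (1 + t))"
  using branch_inj [of t t "- 1"] by (auto simp: sol1_eq_branch sol2_eq_branch)

section \<open>The positive root\<close>

text \<open>
  Solving the cubic for the parameter \<open>t\<close>, in which it is linear: this is the \<open>t\<close> whose cubic has root
  \<open>u\<close>.
\<close>

definition root_param :: "real \<Rightarrow> real" where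
  "root_param u = 2 * u\<^sup>2 * (2 * u + 1) / (1 - u)"

lemma cubic_eq_0_iff_root_param: "u < 1 \<Longrightarrow> cubic t u = 0 \<longleftrightarrow> t = root_param u"
  by (auto simp: cubic_def root_param_def field_simps power2_eq_square power3_eq_cube)

lemma root_param_strict_mono: "strict_mono_on {0<..<1} root_param"
proof (rule strict_mono_onI)
  fix u v :: real assume *: "u \<in> {0<..<1}" "v \<in> {0<..<1}" "u < v"
  have sq: "u\<^sup>2 < v\<^sup>2" using * by (intro power_strict_mono) auto
  have "2 * u\<^sup>2 * (2 * u + 1) < 2 * v\<^sup>2 * (2 * v + 1)"
    by (rule mult_strict_mono) (use * sq in auto)
  then show "root_param u < root_param v"
    unfolding root_param_def using * by (intro frac_less) auto
qed

lemma root_param_image: "root_param ` {0<..<1} = {0<..}"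
proof (intro subset_antisym subsetI)
  fix t assume "t \<in> root_param ` {0<..<1}"
  then show "t \<in> {0<..}" by (auto simp: root_param_def)
next
  fix t :: real assume t: "t \<in> {0<..}"
  have "\<exists>u. 0 \<le> u \<and> u \<le> 1 \<and> cubic t u = 0"
    by (rule IVT') (use t in \<open>auto simp: cubic_def intro!: continuous_intros\<close>)
  then obtain u where u: "0 \<le> u" "u \<le> 1" "cubic t u = 0" by blast
  with t have "u \<noteq> 0" "u \<noteq> 1" by (auto simp: cubic_def)
  with u cubic_eq_0_iff_root_param [of u t] show "t \<in> root_param ` {0<..<1}" by auto
qed

text \<open>
  An injective continuous real function on an interval is a homeomorphism onto its image, so the root
  depends continuously on \<open>t\<close>.
\<close>

lemma ex_continuous_positive_root:
  obtains w where "continuous_on {0<..} w"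
    "\<And>t. t > 0 \<Longrightarrow> 0 < w t \<and> w t < 1"
    "\<And>t u. t > 0 \<Longrightarrow> u > 0 \<Longrightarrow> cubic t u = 0 \<longleftrightarrow> u = w t"
proof -
  have "\<exists>w. homeomorphism {0<..<1} {0<..} root_param w"
  proof (rule homeomorphism_into_1d)
    show "continuous_on {0<..<1} root_param"
      unfolding root_param_def by (intro continuous_intros) auto
    show "inj_on root_param {0<..<1}"
      using root_param_strict_mono by (rule strict_mono_on_imp_inj_on)
  qed (simp_all add: root_param_image is_interval_path_connected)
  then obtain w where w: "homeomorphism {0<..<1} {0<..} root_param w" ..
  have w01: "0 < w t \<and> w t < 1" if "t > 0" for t
    using homeomorphism_image2 [OF w] that by auto
  have "cubic t u = 0 \<longleftrightarrow> u = w t" if "t > 0" "u > 0" for t u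
  proof (cases "u < 1")
    case True
    then have "cubic t u = 0 \<longleftrightarrow> t = root_param u" by (rule cubic_eq_0_iff_root_param)
    also have "\<dots> \<longleftrightarrow> u = w t"
      using homeomorphism_apply1 [OF w, of u] homeomorphism_apply2 [OF w, of t] that True by auto
    finally show ?thesis .
  next
    case False
    then have "t * (u - 1) \<ge> 0" "4 * u ^ 3 + 2 * u\<^sup>2 > 0"
      using that by (simp_all add: add_pos_pos)
    then have "cubic t u > 0" by (simp add: cubic_def right_diff_distrib)
    then show ?thesis using w01 [of t] that False by auto
  qed
  then show thesis using that homeomorphism_cont2 [OF w] w01 by blast
qed

section \<open>Negative roots and the critical parameter\<close>

text \<open>
  The positive zero of \<open>4 * t^2 + 143 * t - 8\<close>, the nontrivial factor of the discriminant of the cubic.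
\<close>

definition t_crit :: real where "t_crit = (19 * sqrt 57 - 143) / 8"

lemma sqrt_57_bounds: "7.54 < sqrt 57" "sqrt 57 < 7.6"
  by (rule real_less_rsqrt, simp add: power2_eq_square,
      rule real_less_lsqrt, simp_all add: power2_eq_square)

lemma t_crit_bounds: "0 < t_crit" "t_crit < 1 / 4"
  using sqrt_57_bounds by (simp_all add: t_crit_def)

lemma eta_bar_eq: "eta_bar = 3 / (1 + t_crit)"
proof -
  have "sqrt 57 * sqrt 57 = 57" by simp
  then have "eta_bar * (1 + t_crit) = 3" by (simp add: eta_bar_def t_crit_def field_simps)
  then show ?thesis using t_crit_bounds by (simp add: field_simps)
qed

lemma eta_bar_unique_positive_root:
  fixes x :: real
  shows "x > 0 \<and> 49 * x\<^sup>2 - 135 * x - 12 = 0 \<longleftrightarrow> x = eta_bar"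
proof -
  define y where "y = 135 / 98 - 19 / 98 * sqrt 57"
  have q: "sqrt 57 * sqrt 57 = 57" by simp
  have "49 * x\<^sup>2 - 135 * x - 12 = 49 * ((x - eta_bar) * (x - y))"
    using q by (simp add: eta_bar_def y_def power2_eq_square field_simps)
  moreover have "y < 0" "eta_bar > 0" using sqrt_57_bounds by (simp_all add: y_def eta_bar_def)
  ultimately show ?thesis by auto
qed

text \<open>
  The double root is the critical point of \<open>root_param\<close> between \<open>- 1 / 2\<close> and \<open>0\<close>, a zero of
  \<open>4 * u^2 - 5 * u - 2\<close>; the simple root follows from the sum \<open>- 1 / 2\<close> of all roots.
\<close>

lemma cubic_t_crit:
  "cubic t_crit u = 4 * (u - (5 - sqrt 57) / 8)\<^sup>2 * (u - (sqrt 57 - 7) / 4)"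
proof -
  define q where "q = sqrt 57"
  have q: "q * q = 57" by (simp add: q_def)
  have q': "q * (q * z) = 57 * z" for z using q by (metis mult.assoc)
  show ?thesis unfolding cubic_def t_crit_def q_def [symmetric]
    by (simp add: power2_eq_square power3_eq_cube field_simps q q')
qed

lemma cubic_shift: "cubic t u = cubic t' u + (t - t') * (u - 1)"
  by (simp add: cubic_def algebra_simps)

text \<open>
  At \<open>t_crit\<close> the cubic is nonpositive for all \<open>u \<le> 0\<close>, since it only touches \<open>0\<close> at the double root.
  A larger \<open>t\<close> makes it negative there.
\<close>

lemma no_negative_root:
  assumes "t_crit < t" "cubic t u = 0"
  shows "u > 0"
proof (rule ccontr)
  assume "\<not> u > 0"
  then have u: "u \<le> 0" by simp
  have "cubic t_crit u \<le> 0"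
    unfolding cubic_t_crit using u sqrt_57_bounds by (intro mult_nonneg_nonpos) auto
  moreover have "(t - t_crit) * (u - 1) < 0" using assms u by (intro mult_pos_neg) auto
  ultimately show False using assms cubic_shift [of t u t_crit] by simp
qed

text \<open>
  For smaller \<open>t\<close> the value at the former double root becomes positive, while the values at \<open>- 1 / 2\<close>
  and \<open>0\<close> are \<open>- 3 * t / 2\<close> and \<open>- t\<close>; the intermediate value theorem gives a root on either side.
\<close>

lemma ex_two_negative_roots:
  assumes t: "0 < t" "t < t_crit"
  obtains r s where "r < s" "s < 0" "cubic t r = 0" "cubic t s = 0"
proof -
  define c where "c = (5 - sqrt 57) / 8"
  have c: "- 1 / 2 < c" "c < 0" using sqrt_57_bounds by (auto simp: c_def)
  have "(t - t_crit) * (c - 1) > 0" using t c by (intro mult_neg_neg) auto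
  then have c0: "cubic t c > 0"
    using cubic_t_crit [of c] cubic_shift [of t c t_crit] by (simp add: c_def)
  have cont: "continuous_on A (cubic t)" for A
    unfolding cubic_def by (intro continuous_intros)
  have "\<exists>r. - 1 / 2 \<le> r \<and> r \<le> c \<and> cubic t r = 0"
    by (rule IVT') (use t c c0 cont in \<open>auto simp: cubic_def power2_eq_square power3_eq_cube\<close>)
  moreover have "\<exists>s. c \<le> s \<and> s \<le> 0 \<and> cubic t s = 0"
    by (rule IVT2') (use t c c0 cont in \<open>auto simp: cubic_def\<close>)
  ultimately obtain r s where *: "r \<le> c" "c \<le> s" "s \<le> 0" "cubic t r = 0" "cubic t s = 0" by blast
  with c0 have "r \<noteq> c" "s \<noteq> c" by auto
  moreover have "s \<noteq> 0" using * t by (auto simp: cubic_def)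
  ultimately show thesis using * by (intro that [of r s]) auto
qed

section \<open>Coincidences of the radius\<close>

text \<open>
  The relations between roots and coefficients, obtained from divided differences of the cubic.
\<close>

lemma cubic_vieta:
  assumes r: "cubic t a = 0" "cubic t b = 0" "cubic t c = 0" and d: "a \<noteq> b" "a \<noteq> c" "b \<noteq> c"
  shows "a + b + c = - 1 / 2" "a * b * c = t / 4"
proof -
  have quot: "4 * (x\<^sup>2 + x * y + y\<^sup>2) + 2 * (x + y) + t = 0"
    if "cubic t x = 0" "cubic t y = 0" "x \<noteq> y" for x y
  proof -
    have "(x - y) * (4 * (x\<^sup>2 + x * y + y\<^sup>2) + 2 * (x + y) + t) = cubic t x - cubic t y"
      by (simp add: cubic_def power2_eq_square power3_eq_cube algebra_simps)
    with that show ?thesis by simp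
  qed
  have "(b - c) * (4 * (a + b + c) + 2) = (4 * (a\<^sup>2 + a * b + b\<^sup>2) + 2 * (a + b) + t)
      - (4 * (a\<^sup>2 + a * c + c\<^sup>2) + 2 * (a + c) + t)"
    by (simp add: power2_eq_square algebra_simps)
  also have "\<dots> = 0" using quot [of a b] quot [of a c] r d by simp
  finally show sum: "a + b + c = - 1 / 2" using d by simp
  have c: "c = - 1 / 2 - a - b" using sum by simp
  have t: "t = - (4 * (a\<^sup>2 + a * b + b\<^sup>2) + 2 * (a + b))" using quot [of a b] r d by simp
  have "0 = 4 * a ^ 3 + 2 * a\<^sup>2 + t * a - t" using r by (simp add: cubic_def)
  also have "\<dots> = 4 * (a * b * c) - t"
    unfolding c t by (simp add: power2_eq_square power3_eq_cube algebra_simps)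
  finally show "a * b * c = t / 4" by simp
qed

text \<open>
  Equality of the radii factors as
  \<open>(a - b) * (a * b - t) * (a + b) * (a * b + t) = 0\<close>. Each of the last three factors determines the
  third root \<open>c\<close> as \<open>1 / 4\<close>, \<open>- 1 / 2\<close> or \<open>- 1 / 4\<close>, because the product of the roots is \<open>t / 4\<close> and
  their sum is \<open>- 1 / 2\<close>. Substituting \<open>c\<close> into the cubic leaves a linear equation for \<open>t\<close>,
  which has no positive solution for \<open>c = - 1 / 2\<close>.
\<close>

lemma roots_equal_rho:
  assumes t: "t > 0" and r: "cubic t a = 0" "cubic t b = 0" "cubic t c = 0"
    and d: "a \<noteq> b" "a \<noteq> c" "b \<noteq> c" and rho: "rho (branch t a) = rho (branch t b)"
  shows "t = 1 / 4 \<or> t = 1 / 20"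
proof -
  have nz: "a \<noteq> 0" "b \<noteq> 0" using r t by (auto simp: cubic_def)
  note v = cubic_vieta [OF r d]
  have "(a\<^sup>2 + t)\<^sup>2 * b\<^sup>2 = (b\<^sup>2 + t)\<^sup>2 * a\<^sup>2"
    using rho nz t by (simp add: branch_def frac_eq_eq)
  then have "((a - b) * (a * b - t)) * ((a + b) * (a * b + t)) = 0"
    by (simp add: power2_eq_square algebra_simps)
  then consider "a * b = t" | "a * b = - t" | "b = - a" using d by auto
  then show ?thesis
  proof cases
    case 1
    then have c: "c = 1 / 4" using v(2) t by simp
    show ?thesis using r(3) unfolding c
      by (simp add: cubic_def power2_eq_square power3_eq_cube)
  next
    case 2
    then have "t * (4 * c + 1) = 0" using v(2) by (simp add: algebra_simps)
    then have c: "c = - 1 / 4" using t by simp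
    show ?thesis using r(3) unfolding c
      by (simp add: cubic_def power2_eq_square power3_eq_cube)
  next
    case 3
    then have c: "c = - 1 / 2" using v(1) by simp
    show ?thesis using r(3) t unfolding c by (simp add: cubic_def power2_eq_square power3_eq_cube)
  qed
qed

text \<open>
  Two negative roots and one positive root exhaust the cubic, since the sum of any three distinct roots
  determines the third from the other two.
\<close>

lemma three_roots:
  assumes t: "0 < t" "t < t_crit"
  obtains r s where "r < s" "s < 0"
    "\<And>w u. cubic t w = 0 \<Longrightarrow> w > 0 \<Longrightarrow> cubic t u = 0 \<longleftrightarrow> u \<in> {w, r, s}"
proof -
  obtain r s where rs: "r < s" "s < 0" "cubic t r = 0" "cubic t s = 0"
    using ex_two_negative_roots [OF t] .
  have "u \<in> {w, r, s}" if w: "cubic t w = 0" "w > 0" and u: "cubic t u = 0" for w u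
  proof (rule ccontr)
    assume "u \<notin> {w, r, s}"
    then have "r + s + u = - 1 / 2" "r + s + w = - 1 / 2"
      using cubic_vieta(1) [OF rs(3) rs(4) u] cubic_vieta(1) [OF rs(3) rs(4) w(1)] rs w by auto
    then show False using \<open>u \<notin> {w, r, s}\<close> by simp
  qed
  then show thesis using rs by (intro that [of r s]) auto
qed

section \<open>The classification\<close>

text \<open>
  For \<open>0 < \<eta> < 3\<close> this is the inverse of \<open>t \<mapsto> 3 / (1 + t)\<close>. Geometrically it is the squared height
  of the apex divided by the squared circumradius \<open>\<eta> / 3\<close> of the base triangle.
\<close>

definition apex_ratio :: "real \<Rightarrow> real" where
  "apex_ratio \<eta> = (3 - \<eta>) / \<eta>"

lemma apex_ratio:
  assumes "0 < \<eta>" "\<eta> < 3"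
  shows "apex_ratio \<eta> > 0" "3 / (1 + apex_ratio \<eta>) = \<eta>"
  using assms by (simp_all add: apex_ratio_def field_simps)

lemma apex_ratio_less_iff:
  assumes "0 < \<eta>" "t \<ge> 0"
  shows "apex_ratio \<eta> < t \<longleftrightarrow> 3 / (1 + t) < \<eta>" "t < apex_ratio \<eta> \<longleftrightarrow> \<eta> < 3 / (1 + t)"
  using assms by (auto simp: apex_ratio_def field_simps)

lemma eta_bar_bounds: "0 < eta_bar" "eta_bar < 3"
  using t_crit_bounds by (simp_all add: eta_bar_eq field_simps)

lemma continuous_on_branch:
  assumes "continuous_on A f" "continuous_on A g" "\<And>x. x \<in> A \<Longrightarrow> f x > 0 \<and> g x \<noteq> 0"
  shows "continuous_on A (\<lambda>x. branch (f x) (g x))"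
  unfolding branch_def using assms
  by (intro continuous_intros) (auto simp: add_eq_0_iff dest: assms(3))

theorem theorem4:
  shows "(\<forall>x::real. x > 0 \<and> 49 * x\<^sup>2 - 135 * x - 12 = 0 \<longleftrightarrow> x = eta_bar) \<and>
    (\<forall>l \<eta> :: real. \<forall>s :: complex \<times> complex \<times> complex. l \<noteq> 0 \<longrightarrow>
       (is_solution l \<eta> s \<longleftrightarrow> is_solution 1 (\<eta> / l) (s /\<^sub>R l))) \<and>
    (\<forall>\<eta>::real. \<eta> \<noteq> 3 \<longrightarrow> is_solution 1 \<eta> (sol1 \<eta>) \<and> is_solution 1 \<eta> (sol2 \<eta>)) \<and>
    (\<exists>S T1 T2 T3 :: real \<Rightarrow> real \<times> real \<times> real.
       continuous_on {0<..<eta_bar} S \<and>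
       (\<forall>\<eta>\<in>{0<..<eta_bar}.
          (\<forall>s. is_solution 1 \<eta> s \<longleftrightarrow> s \<in> {sol1 \<eta>, sol2 \<eta>, S \<eta>}) \<and>
          (\<eta> \<noteq> 12 / 5 \<longrightarrow> S \<eta> \<notin> {sol1 \<eta>, sol2 \<eta>}) \<and>
          rho (S \<eta>) > 0 \<and>
          (\<exists>!P. corresponds \<eta> (S \<eta>) P)) \<and>
       (\<forall>\<eta>\<in>{eta_bar<..<3}.
          (\<forall>s. is_solution 1 \<eta> s \<longleftrightarrow> s \<in> {sol1 \<eta>, sol2 \<eta>, T1 \<eta>, T2 \<eta>, T3 \<eta>}) \<and>
          distinct [sol1 \<eta>, sol2 \<eta>, T1 \<eta>, T2 \<eta>, T3 \<eta>] \<and>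
          rho (T1 \<eta>) > 0 \<and> rho (T2 \<eta>) > 0 \<and> rho (T3 \<eta>) > 0 \<and>
          (\<eta> \<noteq> 20 / 7 \<longrightarrow> distinct [rho (T1 \<eta>), rho (T2 \<eta>), rho (T3 \<eta>)]) \<and>
          (\<exists>P1 P2 P3. distinct [P1, P2, P3] \<and>
             (\<forall>P. corresponds \<eta> (T1 \<eta>) P \<longleftrightarrow> P = P1) \<and>
             (\<forall>P. corresponds \<eta> (T2 \<eta>) P \<longleftrightarrow> P = P2) \<and>
             (\<forall>P. corresponds \<eta> (T3 \<eta>) P \<longleftrightarrow> P = P3))) \<and>
       (\<forall>l \<eta> :: real. \<forall>s :: complex \<times> complex \<times> complex.
          is_solution l \<eta> s \<and> \<eta> / l \<noteq> eta_bar \<longrightarrow>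
          l = 0 \<or>
          (let e = \<eta> / l; s' = s /\<^sub>R l in
             s' = cplx_triple (sol1 e) \<or>
             s' = cplx_triple (sol2 e) \<or>
             (e \<in> {0<..<eta_bar} \<and> s' = cplx_triple (S e)) \<or>
             (e \<in> {eta_bar<..<3} \<and> s' \<in> cplx_triple ` {T1 e, T2 e, T3 e}) \<or>
             e \<le> 0 \<or> e \<ge> 3 \<or>
             s' \<notin> range cplx_triple)))"
proof -
  obtain w where w: "continuous_on {0<..} w"
    "\<And>t. t > 0 \<Longrightarrow> 0 < w t \<and> w t < 1"
    "\<And>t u. t > 0 \<Longrightarrow> u > 0 \<Longrightarrow> cubic t u = 0 \<longleftrightarrow> u = w t"
    using ex_continuous_positive_root by blast
  have w0: "cubic t (w t) = 0" if "t > 0" for t using w(2,3) that by blast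
  have "\<exists>p q. p < q \<and> q < 0 \<and> (\<forall>u. cubic t u = 0 \<longleftrightarrow> u \<in> {w t, p, q})"
    if "0 < t" "t < t_crit" for t
    using three_roots [OF that] w(2) w0 that(1) by metis
  then obtain p q where pq: "\<And>t. 0 < t \<Longrightarrow> t < t_crit \<Longrightarrow> p t < q t \<and> q t < 0"
    and roots: "\<And>t u. 0 < t \<Longrightarrow> t < t_crit \<Longrightarrow> cubic t u = 0 \<longleftrightarrow> u \<in> {w t, p t, q t}"
    by metis
  \<comment> \<open>The positive root serves both as \<open>S\<close> below \<open>eta_bar\<close> and as the first branch above it.\<close>
  let ?t = apex_ratio
  define S where "S \<eta> = branch (?t \<eta>) (w (?t \<eta>))" for \<eta>
  define T2 where "T2 \<eta> = branch (?t \<eta>) (p (?t \<eta>))" for \<eta>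
  define T3 where "T3 \<eta> = branch (?t \<eta>) (q (?t \<eta>))" for \<eta>

  have cont: "continuous_on {0<..<eta_bar} S"
  proof -
    have ct: "continuous_on {0<..<eta_bar} ?t"
      unfolding apex_ratio_def by (intro continuous_intros) auto
    have pos: "?t \<eta> > 0" if "\<eta> \<in> {0<..<eta_bar}" for \<eta>
      using apex_ratio(1) [of \<eta>] that eta_bar_bounds by auto
    have "continuous_on {0<..<eta_bar} (\<lambda>\<eta>. w (?t \<eta>))"
      by (rule continuous_on_compose2 [OF w(1) ct]) (use pos in auto)
    with ct show ?thesis unfolding S_def
      by (rule continuous_on_branch) (use pos w(2) in force)
  qed

  have below: "(\<forall>s. is_solution 1 \<eta> s \<longleftrightarrow> s \<in> {sol1 \<eta>, sol2 \<eta>, S \<eta>}) \<and>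
      (\<eta> \<noteq> 12 / 5 \<longrightarrow> S \<eta> \<notin> {sol1 \<eta>, sol2 \<eta>}) \<and> rho (S \<eta>) > 0 \<and>
      (\<exists>!P. corresponds \<eta> (S \<eta>) P)" if \<eta>: "\<eta> \<in> {0<..<eta_bar}" for \<eta>
  proof -
    define t where "t = ?t \<eta>"
    have t: "t > 0" "3 / (1 + t) = \<eta>"
      using apex_ratio [of \<eta>] \<eta> eta_bar_bounds by (auto simp: t_def)
    have "t_crit < t"
      using apex_ratio_less_iff [of \<eta> t_crit] \<eta> t_crit_bounds by (simp add: t_def eta_bar_eq)
    then have root: "cubic t u = 0 \<longleftrightarrow> u = w t" for u
      using no_negative_root [of t u] w(2,3) [OF t(1)] by auto
    have S: "S \<eta> = branch t (w t)" by (simp add: S_def t_def)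
    have 1: "is_solution 1 \<eta> s \<longleftrightarrow> s \<in> {sol1 \<eta>, sol2 \<eta>, S \<eta>}" for s
      using is_solution_iff_cubic_root [OF t(1), of s] by (auto simp: t(2) root S)
    have 2: "S \<eta> \<noteq> sol1 \<eta>" if "\<eta> \<noteq> 12 / 5"
    proof
      assume "S \<eta> = sol1 \<eta>"
      then have "w t = t"
        using branch_root_eq_sol1_iff [OF t(1) w0 [OF t(1)]] by (simp add: t(2) S)
      then have "t = 1 / 4" using w0 [OF t(1)] cubic_self_eq_0_iff [OF t(1)] by simp
      with t(2) that show False by simp
    qed
    have 3: "S \<eta> \<noteq> sol2 \<eta>"
      using branch_root_noteq_sol2 [OF t(1) w0 [OF t(1)]] by (simp add: t(2) S)
    have 4: "rho (S \<eta>) > 0" using rho_branch_pos [of t "w t"] t(1) w(2) [OF t(1)] by (simp add: S)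
    have 5: "\<exists>!P. corresponds \<eta> (S \<eta>) P"
      using corresponds_branch_iff [OF t(1)] by (simp add: t(2) S)
    show ?thesis using 1 2 3 4 5 by auto
  qed

  have above: "(\<forall>s. is_solution 1 \<eta> s \<longleftrightarrow> s \<in> {sol1 \<eta>, sol2 \<eta>, S \<eta>, T2 \<eta>, T3 \<eta>}) \<and>
      distinct [sol1 \<eta>, sol2 \<eta>, S \<eta>, T2 \<eta>, T3 \<eta>] \<and>
      rho (S \<eta>) > 0 \<and> rho (T2 \<eta>) > 0 \<and> rho (T3 \<eta>) > 0 \<and>
      (\<eta> \<noteq> 20 / 7 \<longrightarrow> distinct [rho (S \<eta>), rho (T2 \<eta>), rho (T3 \<eta>)]) \<and>
      (\<exists>P1 P2 P3. distinct [P1, P2, P3] \<and>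
        (\<forall>P. corresponds \<eta> (S \<eta>) P \<longleftrightarrow> P = P1) \<and>
        (\<forall>P. corresponds \<eta> (T2 \<eta>) P \<longleftrightarrow> P = P2) \<and>
        (\<forall>P. corresponds \<eta> (T3 \<eta>) P \<longleftrightarrow> P = P3))" if \<eta>: "\<eta> \<in> {eta_bar<..<3}" for \<eta>
  proof -
    define t where "t = ?t \<eta>"
    have t: "t > 0" "3 / (1 + t) = \<eta>"
      using apex_ratio [of \<eta>] \<eta> eta_bar_bounds by (auto simp: t_def)
    have "0 < \<eta>" using \<eta> eta_bar_bounds by auto
    then have tc: "t < t_crit"
      using apex_ratio_less_iff(1) [of \<eta> t_crit] \<eta> \<open>0 < \<eta>\<close> t_crit_bounds
      by (simp add: t_def eta_bar_eq)
    define a b c where "a = w t" and "b = p t" and "c = q t"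
    have abc: "b < c" "c < 0" "0 < a"
      using pq [OF t(1) tc] w(2) [OF t(1)] by (simp_all add: a_def b_def c_def)
    have S: "S \<eta> = branch t a" "T2 \<eta> = branch t b" "T3 \<eta> = branch t c"
      by (simp_all add: S_def T2_def T3_def t_def a_def b_def c_def)
    have root: "cubic t u = 0 \<longleftrightarrow> u \<in> {a, b, c}" for u
      using roots [OF t(1) tc] by (simp add: a_def b_def c_def)
    have "t \<noteq> 1 / 4" using tc t_crit_bounds by simp
    then have "u \<noteq> t" if "cubic t u = 0" for u
      using that cubic_self_eq_0_iff [OF t(1)] by auto
    then have sols: "branch t u \<noteq> sol1 \<eta> \<and> branch t u \<noteq> sol2 \<eta>" if "u \<in> {a, b, c}" for u
      using branch_root_eq_sol1_iff [OF t(1), of u] branch_root_noteq_sol2 [OF t(1), of u]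
        that root t(2) by simp
    have inj: "branch t u = branch t v \<longleftrightarrow> u = v" for u v using branch_inj [OF t(1)] by blast
    have pinj: "axis_point t u = axis_point t v \<longleftrightarrow> u = v" for u v
      using axis_point_inj [OF t(1)] by blast
    have 1: "is_solution 1 \<eta> s \<longleftrightarrow> s \<in> {sol1 \<eta>, sol2 \<eta>, S \<eta>, T2 \<eta>, T3 \<eta>}" for s
      using is_solution_iff_cubic_root [OF t(1), of s] by (auto simp: t(2) root S)
    have 2: "distinct [sol1 \<eta>, sol2 \<eta>, S \<eta>, T2 \<eta>, T3 \<eta>]"
      using sol1_noteq_sol2 [OF t(1)] sols [of a] sols [of b] sols [of c] abc
      by (auto simp: S inj t(2))
    have 3: "rho (S \<eta>) > 0" "rho (T2 \<eta>) > 0" "rho (T3 \<eta>) > 0"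
      using rho_branch_pos [OF t(1)] abc by (auto simp: S)
    have 4: "distinct [rho (S \<eta>), rho (T2 \<eta>), rho (T3 \<eta>)]" if "\<eta> \<noteq> 20 / 7"
    proof -
      have "t \<noteq> 1 / 20"
      proof
        assume "t = 1 / 20"
        then have "3 / (1 + t) = 20 / 7" by (simp only:) simp
        with t(2) that show False by simp
      qed
      then have ne: "rho (branch t x) \<noteq> rho (branch t y)"
        if "{x, y, z} = {a, b, c}" "x \<noteq> y" "x \<noteq> z" "y \<noteq> z" for x y z
        using roots_equal_rho [OF t(1), of x y z] root [of x] root [of y] root [of z]
          \<open>t \<noteq> 1 / 4\<close> that by blast
      show ?thesis using ne [of a b c] ne [of a c b] ne [of b c a] abc by (auto simp: S)
    qed
    have 5: "\<forall>P. corresponds \<eta> (S \<eta>) P \<longleftrightarrow> P = axis_point t a"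
      "\<forall>P. corresponds \<eta> (T2 \<eta>) P \<longleftrightarrow> P = axis_point t b"
      "\<forall>P. corresponds \<eta> (T3 \<eta>) P \<longleftrightarrow> P = axis_point t c"
      using corresponds_branch_iff [OF t(1)] by (simp_all add: S t(2))
    have 6: "distinct [axis_point t a, axis_point t b, axis_point t c]"
      using abc by (simp add: pinj)
    show ?thesis using 1 2 3 4 5 6 by blast
  qed

  \<comment> \<open>Only real triples with \<open>0 < e < 3\<close> remain, and these solve the real system.\<close>
  have complex: "l = 0 \<or>
      (let e = \<eta> / l; s' = s /\<^sub>R l in
         s' = cplx_triple (sol1 e) \<or> s' = cplx_triple (sol2 e) \<or>
         (e \<in> {0<..<eta_bar} \<and> s' = cplx_triple (S e)) \<or>
         (e \<in> {eta_bar<..<3} \<and> s' \<in> cplx_triple ` {S e, T2 e, T3 e}) \<or>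
         e \<le> 0 \<or> e \<ge> 3 \<or> s' \<notin> range cplx_triple)"
    if s: "is_solution l \<eta> s \<and> \<eta> / l \<noteq> eta_bar" for l \<eta> :: real and s :: "complex \<times> complex \<times> complex"
  proof -
    define e where "e = \<eta> / l"
    have "s /\<^sub>R l = cplx_triple (sol1 e) \<or> s /\<^sub>R l = cplx_triple (sol2 e) \<or>
         (e \<in> {0<..<eta_bar} \<and> s /\<^sub>R l = cplx_triple (S e)) \<or>
         (e \<in> {eta_bar<..<3} \<and> s /\<^sub>R l \<in> cplx_triple ` {S e, T2 e, T3 e})"
      if l: "l \<noteq> 0" and e: "0 < e" "e < 3" and r: "s /\<^sub>R l = cplx_triple r" for r
    proof -
      have "is_solution 1 e r"
        using s is_solution_homogeneous [OF l, of \<eta> s] r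
        by (simp add: is_solution_cplx_triple_iff e_def)
      moreover have "e \<in> {0<..<eta_bar} \<or> e \<in> {eta_bar<..<3}" using e s by (auto simp: e_def)
      ultimately show ?thesis using below [of e] above [of e] r by fastforce
    qed
    then show ?thesis unfolding Let_def e_def [symmetric] by (metis image_iff not_le)
  qed

  show ?thesis
    apply (rule conjI, rule allI, rule eta_bar_unique_positive_root)
    apply (rule conjI, intro allI impI, erule is_solution_homogeneous)
    apply (rule conjI, intro allI impI conjI, erule is_solution_sol1, erule is_solution_sol2)
    apply (rule exI [of _ S], rule exI [of _ S], rule exI [of _ T2], rule exI [of _ T3])
    apply (rule conjI, rule cont)
    apply (rule conjI, rule ballI, erule below)
    apply (rule conjI, rule ballI, erule above)
    apply (intro allI, rule impI, erule complex)
    done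
qed

end
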